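(* Let $(A,\cdot)$ be a commutative associative algebra over $\mathbf{k}$ and let $\phi\in\Gamma((A,\cdot))$. Define a binary operation $\circ$ on $A$ by $x\circ y:=x\cdot\phi(y)$ for all $x,y\in A$. Then $(A,\cdot,\circ)$ is a transposed Novikov-Poisson algebra.
   Context: $\mathbf{k}$ is a field of characteristic not equal to $2$; all binary operations are $\mathbf{k}$-bilinear and algebras need not be unital. The centroid $\Gamma((A,\cdot))$ is the set of linear maps $\phi:A\to A$ such that $\phi(x\cdot y)=x\cdot\phi(y)=\phi(x)\cdot y$ for all $x,y\in A$. A (left) Novikov algebra $(A,\circ)$ is a vector space with a binary operation satisfying $(x\circ y)\circ z=(x\circ z)\circ y$ and $(x\circ y)\circ z-x\circ(y\circ z)=(y\circ x)\circ z-y\circ(x\circ z)$ for all $x,y,z$. A transposed Novikov-Poisson algebra is a triple $(A,\cdot,\circ)$ where $(A,\cdot)$ is a commutative associative algebra, $(A,\circ)$ is a Novikov algebra, and for all $x,y,z\in A$: $(x\cdot y)\circ z=(x\cdot z)\circ y$ and $2z\cdot(x\circ y)=(z\cdot x)\circ y+x\circ(z\cdot y)$. *)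

theory Defs
  imports Complex_Main
begin

text \<open>
  Algebras live on a whole type: \<open>s\<close> is the scalar multiplication of a vector space structure on
  \<open>'a\<close>, and the algebra products are explicit binary operations on \<open>'a\<close>, unrelated to
  any type class multiplication.  No unit is required.
\<close>

locale nonassoc_algebra = vector_space s
  for s :: "'k::field \<Rightarrow> 'a::ab_group_add \<Rightarrow> 'a" +
  fixes m :: "'a \<Rightarrow> 'a \<Rightarrow> 'a"
  assumes linear_left: "Vector_Spaces.linear s s (\<lambda>x. m x y)"
    and linear_right: "Vector_Spaces.linear s s (\<lambda>y. m x y)"

locale comm_assoc_algebra = nonassoc_algebra s m
  for s :: "'k::field \<Rightarrow> 'a::ab_group_add \<Rightarrow> 'a"
    and m :: "'a \<Rightarrow> 'a \<Rightarrow> 'a" +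
  assumes comm: "m x y = m y x"
    and assoc: "m (m x y) z = m x (m y z)"

definition centroid ::
    "('k::field \<Rightarrow> 'a::ab_group_add \<Rightarrow> 'a) \<Rightarrow> ('a \<Rightarrow> 'a \<Rightarrow> 'a) \<Rightarrow> ('a \<Rightarrow> 'a) set" where
  "centroid s m = {\<phi>. Vector_Spaces.linear s s \<phi> \<and>
     (\<forall>x y. \<phi> (m x y) = m x (\<phi> y) \<and> m x (\<phi> y) = m (\<phi> x) y)}"

locale left_novikov_algebra = nonassoc_algebra s c
  for s :: "'k::field \<Rightarrow> 'a::ab_group_add \<Rightarrow> 'a"
    and c :: "'a \<Rightarrow> 'a \<Rightarrow> 'a" +
  assumes right_comm: "c (c x y) z = c (c x z) y"
    and left_symm: "c (c x y) z - c x (c y z) = c (c y x) z - c y (c x z)"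

locale transposed_novikov_poisson_algebra =
  dot: comm_assoc_algebra s m + circ: left_novikov_algebra s c
  for s :: "'k::field \<Rightarrow> 'a::ab_group_add \<Rightarrow> 'a"
    and m :: "'a \<Rightarrow> 'a \<Rightarrow> 'a"
    and c :: "'a \<Rightarrow> 'a \<Rightarrow> 'a" +
  assumes dot_circ: "c (m x y) z = c (m x z) y"
    and transposed_leibniz: "s 2 (m z (c x y)) = c (m z x) y + c x (m z y)"

end

theory Submission
  imports Defs
begin

text \<open>
  An element \<open>\<phi>\<close> of the centroid can be pulled out of either factor of a product, so
  \<open>x \<circ> y = x \<cdot> \<phi> y = \<phi> (x \<cdot> y)\<close>.  Every iterated product of \<open>x\<close>, \<open>y\<close>, \<open>z\<close> built from \<open>\<cdot>\<close> and
  \<open>\<circ>\<close> is therefore \<open>\<phi>\<close>, applied as many times as \<open>\<circ>\<close> occurs, to the single element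
  \<open>x \<cdot> y \<cdot> z\<close>, whatever the order and the bracketing.  In each of the identities to be checked,
  the terms have the same number of occurrences of \<open>\<circ>\<close>, so they coincide: left symmetry reads
  \<open>0 = 0\<close>, and the transposed Leibniz rule reads \<open>2 v = v + v\<close> with \<open>v = \<phi> (x \<cdot> y \<cdot> z)\<close>.
\<close>

context comm_assoc_algebra
begin

lemma left_comm: "m x (m y z) = m y (m x z)"
  by (metis assoc comm)

text \<open>
  Oriented towards \<open>\<phi>\<close> on the outside, these two equations, together with the rules for the
  commutative associative product, rewrite every mixed product to its normal form
  \<open>\<phi> (\<dots> (\<phi> (x \<cdot> (y \<cdot> z))))\<close>.
\<close>
lemma centroid_pull_out:
  assumes "\<phi> \<in> centroid s m"
  shows "m x (\<phi> y) = \<phi> (m x y)" and "m (\<phi> x) y = \<phi> (m x y)"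
  using assms by (auto simp: centroid_def)

end

theorem proposition2p13:
  fixes s :: "'k::field \<Rightarrow> 'a::ab_group_add \<Rightarrow> 'a"
    and m :: "'a \<Rightarrow> 'a \<Rightarrow> 'a"
    and \<phi> :: "'a \<Rightarrow> 'a"
  assumes "CHAR('k) \<noteq> 2"
    and "comm_assoc_algebra s m"
    and "\<phi> \<in> centroid s m"
  shows "transposed_novikov_poisson_algebra s m (\<lambda>x y. m x (\<phi> y))"
proof -
  interpret comm_assoc_algebra s m
    by fact
  note pull_out = centroid_pull_out[OF \<open>\<phi> \<in> centroid s m\<close>]
  have linear_\<phi>: "Vector_Spaces.linear s s \<phi>"
    using \<open>\<phi> \<in> centroid s m\<close> by (simp add: centroid_def)
  have double: "s 2 v = v + v" for v
    using scale_left_distrib[of 1 1 v] by simp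
  have "Vector_Spaces.linear s s (\<lambda>y. m x (\<phi> y))" for x
    using Vector_Spaces.linear_compose[OF linear_\<phi> linear_right[of x]] by (simp add: o_def)
  then interpret circ: nonassoc_algebra s "\<lambda>x y. m x (\<phi> y)"
    by (intro nonassoc_algebra.intro nonassoc_algebra_axioms.intro vector_space_axioms linear_left)
  show ?thesis
    by unfold_locales (simp_all add: pull_out double assoc comm left_comm)
qed

end
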